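(* Let $n$ be an even positive integer and let $P = \overline{\mathcal{P}_{n/2,n}}$. For every rotation $R : \mathbb{R}^n \to \mathbb{R}^n$ and every positive integer $k \le \frac{n}{200^3}$, we have $$d\big(R(P), (R(P))^k\big) = \Omega(\sqrt{n}),$$ that is, there are absolute constants $c > 0$ and $n_0$ such that for all even $n \ge n_0$, all rotations $R$ of $\mathbb{R}^n$ and all positive integers $k \le n/200^3$, $d\big(R(P), (R(P))^k\big) \ge c\sqrt{n}$.
   Context: A rotation of $\mathbb{R}^n$ is a linear map given by an orthogonal matrix of determinant $1$. For a real $t$ and a positive integer $n$, $\mathcal{P}_{t,n} = \{x \in [0,1]^n : \sum_{i=1}^n x_i \le t\}$. For $x \in \mathbb{R}^n$ and $I \subseteq [n] = \{1,\dots,n\}$, $x^I \in \mathbb{R}^n$ is the vector with $x^I_i = x_i$ if $i \in I$ and $x^I_i = -x_i$ if $i \notin I$; for $P \subseteq \mathbb{R}^n$, $P^I = \{x^I : x \in P\}$. For a polytope $P \subseteq \mathbb{R}^n_+$ its symmetrized version is $\overline{P} = \mathrm{conv}\left(\bigcup_{I \subseteq [n]} P^I\right)$. An inequality $\alpha x \le \beta$ (with $\alpha\in\mathbb{R}^n$, $\beta\in\mathbb{R}$, and $\alpha x$ denoting the inner product) is called $k$-sparse if $\alpha$ has at most $k$ non-zero components. It is valid for $P\subseteq\mathbb{R}^n$ if it is satisfied by all points of $P$. For a polytope $P \subset \mathbb{R}^n$ and a positive integer $k$, $P^k$ (integer superscript) denotes the set of points of $\mathbb{R}^n$ satisfying all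 $k$-sparse inequalities valid for $P$. For polytopes $P \subseteq Q$ in $\mathbb{R}^n$, $d(P,Q) = \max_{x\in Q}\min_{y \in P}\|x-y\|$, where $\|\cdot\|$ is the Euclidean norm. *)

theory Defs
  imports Complex_Main "Jordan_Normal_Form.Determinant"
begin

text \<open>The dimension is quantified inside the statement, so $\mathbb{R}^n$ is rendered as
  \<^term>\<open>carrier_vec n :: real vec set\<close>, with coordinates indexed by \<open>0, \<dots>, n - 1\<close>.\<close>

definition l2_norm_vec :: "real vec \<Rightarrow> real" where
  "l2_norm_vec x = sqrt (x \<bullet> x)"

definition is_rotation :: "nat \<Rightarrow> (real vec \<Rightarrow> real vec) \<Rightarrow> bool" where
  "is_rotation n R \<longleftrightarrow>
     (\<exists>A \<in> carrier_mat n n. transpose_mat A * A = 1\<^sub>m n \<and> det A = 1 \<and>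
        (\<forall>x \<in> carrier_vec n. R x = A *\<^sub>v x))"

definition convex_vec_set :: "nat \<Rightarrow> real vec set \<Rightarrow> bool" where
  "convex_vec_set n C \<longleftrightarrow> C \<subseteq> carrier_vec n \<and>
     (\<forall>x \<in> C. \<forall>y \<in> C. \<forall>u \<ge> 0. \<forall>v \<ge> 0. u + v = 1 \<longrightarrow> u \<cdot>\<^sub>v x + v \<cdot>\<^sub>v y \<in> C)"

definition conv_vec :: "nat \<Rightarrow> real vec set \<Rightarrow> real vec set" where
  "conv_vec n S = convex_vec_set n hull S"

definition budget_polytope :: "real \<Rightarrow> nat \<Rightarrow> real vec set" where
  "budget_polytope t n =
     {x \<in> carrier_vec n. (\<forall>i<n. 0 \<le> x $ i \<and> x $ i \<le> 1) \<and> (\<Sum>i<n. x $ i) \<le> t}"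

definition reflect_vec :: "nat \<Rightarrow> nat set \<Rightarrow> real vec \<Rightarrow> real vec" where
  "reflect_vec n I x = vec n (\<lambda>i. if i \<in> I then x $ i else - x $ i)"

definition symmetrized :: "nat \<Rightarrow> real vec set \<Rightarrow> real vec set" where
  "symmetrized n P = conv_vec n (\<Union>I \<in> Pow {..<n}. reflect_vec n I ` P)"

definition sparse_vec :: "nat \<Rightarrow> real vec \<Rightarrow> bool" where
  "sparse_vec k a \<longleftrightarrow> card {i. i < dim_vec a \<and> a $ i \<noteq> 0} \<le> k"

definition valid_ineq :: "real vec \<Rightarrow> real \<Rightarrow> real vec set \<Rightarrow> bool" where
  "valid_ineq a b P \<longleftrightarrow> (\<forall>x \<in> P. a \<bullet> x \<le> b)"

definition sparse_closure :: "nat \<Rightarrow> nat \<Rightarrow> real vec set \<Rightarrow> real vec set" where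
  "sparse_closure n k P =
     {x \<in> carrier_vec n. \<forall>a \<in> carrier_vec n. \<forall>b.
        sparse_vec k a \<longrightarrow> valid_ineq a b P \<longrightarrow> a \<bullet> x \<le> b}"

text \<open>For nonempty polytopes the supremum and the infimum below are attained, so they are the
  maximum and the minimum. Note that the sparse closure of a bounded set is bounded for every
  positive sparsity, because the bounds on single coordinates are 1-sparse.\<close>

definition poly_dist :: "real vec set \<Rightarrow> real vec set \<Rightarrow> real" where
  "poly_dist P Q = (SUP x \<in> Q. INF y \<in> P. l2_norm_vec (x - y))"

end

theory Submission imports Defs begin

text \<open>Let \<open>A\<close> be the matrix of the rotation. The far point is \<open>A y\<close> with \<open>y = (1/2 + \<epsilon>) s\<close> for a sign vector
  \<open>s\<close>: its \<open>\<ell>\<^sub>1\<close>-norm exceeds that of every point of the polytope by \<open>\<epsilon> n\<close>, so it lies at distance at least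
  \<open>\<epsilon> \<surd>n\<close>. The support function of the polytope at \<open>b\<close> is the sum of the \<open>n/2\<close> largest \<open>\<bar>b\<^sub>i\<bar>\<close>, and it
  dominates \<open>b \<bullet> y\<close> as soon as \<open>s\<close> disagrees with the sign pattern of \<open>b\<close> in a constant fraction of the
  coordinates. So \<open>s\<close> only has to be far in Hamming distance from the sign patterns of all \<open>b = A\<^sup>T a\<close> with
  \<open>a\<close> sparse. For a fixed support these patterns have VC dimension at most \<open>k\<close>, so by Pajor's form of
  the Sauer--Shelah lemma the union of all Hamming balls around them has fewer than \<open>2\<^sup>n\<close> elements.\<close>

section \<open>Counting sign patterns\<close>

text \<open>Gaussian elimination, one coordinate at a time: a vector \<open>p\<close> that is
  nonzero at \<open>i0\<close> serves as pivot, and the other vectors, cleared at \<open>i0\<close>,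
  are dependent by induction.\<close>

lemma exists_dependency:
  fixes v :: "'a \<Rightarrow> 'b \<Rightarrow> real"
  assumes "finite I" "finite S" "card I < card S"
  shows "\<exists>c. (\<exists>j\<in>S. c j \<noteq> 0) \<and> (\<forall>i\<in>I. (\<Sum>j\<in>S. c j * v j i) = 0)"
  using assms
proof (induction I arbitrary: S v rule: finite_induct)
  case empty
  then obtain j where "j \<in> S" by (metis card.empty less_nat_zero_code all_not_in_conv)
  then show ?case by (auto intro!: exI[of _ "\<lambda>_. 1"])
next
  case (insert i0 I)
  show ?case
  proof (cases "\<forall>j\<in>S. v j i0 = 0")
    case True
    have "card I < card S" using insert by simp
    from insert.IH[OF insert.prems(1) this, of v] obtain c
      where c: "\<exists>j\<in>S. c j \<noteq> 0" "\<forall>i\<in>I. (\<Sum>j\<in>S. c j * v j i) = 0" by blast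
    have "(\<Sum>j\<in>S. c j * v j i0) = 0" using True by (intro sum.neutral) auto
    with c show ?thesis by (intro exI[of _ c]) auto
  next
    case False
    then obtain p where p: "p \<in> S" "v p i0 \<noteq> 0" by blast
    define w where "w j i = v j i - v j i0 / v p i0 * v p i" for j i
    have "card I < card (S - {p})" "finite (S - {p})" using insert p by auto
    from insert.IH[OF this(2) this(1), of w] obtain c where
      c: "\<exists>j\<in>S - {p}. c j \<noteq> 0" "\<forall>i\<in>I. (\<Sum>j\<in>S - {p}. c j * w j i) = 0" by blast
    \<comment> \<open>The coefficient of \<open>p\<close> collects the multiples of
      \<open>v p\<close> subtracted in \<open>w\<close>, so \<open>d\<close> on \<open>v\<close> and
      \<open>c\<close> on \<open>w\<close> give the same combination, also at \<open>i0\<close>,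
      where every \<open>w j\<close> vanishes.\<close>
    define d where "d = c(p := - (\<Sum>j\<in>S - {p}. c j * (v j i0 / v p i0)))"
    have d: "(\<Sum>j\<in>S. d j * v j i) = (\<Sum>j\<in>S - {p}. c j * w j i)" for i
    proof -
      have "(\<Sum>j\<in>S. d j * v j i) = d p * v p i + (\<Sum>j\<in>S - {p}. d j * v j i)"
        using insert.prems(1) p(1) by (rule sum.remove)
      also have "(\<Sum>j\<in>S - {p}. d j * v j i) = (\<Sum>j\<in>S - {p}. c j * v j i)"
        by (intro sum.cong) (auto simp: d_def)
      finally show ?thesis
        by (simp add: d_def w_def right_diff_distrib sum_subtractf sum_distrib_right mult.assoc)
    qed
    have "(\<Sum>j\<in>S. d j * v j i0) = 0" unfolding d using p(2) by (simp add: w_def)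
    moreover have "\<exists>j\<in>S. d j \<noteq> 0" using c(1) by (auto simp: d_def)
    ultimately show ?thesis using c(2) d by (intro exI[of _ d]) auto
  qed
qed

section \<open>Shattering and Pajor's inequality\<close>

definition shatters :: "'a set set \<Rightarrow> 'a set \<Rightarrow> bool" where
  "shatters F S \<longleftrightarrow> (\<forall>T\<subseteq>S. \<exists>A\<in>F. A \<inter> S = T)"

lemma shattersE:
  assumes "shatters F S" "T \<subseteq> S"
  obtains A where "A \<in> F" "A \<inter> S = T"
  using assms unfolding shatters_def by blast

lemma shatters_mono:
  assumes "shatters F S" "F \<subseteq> G"
  shows "shatters G S"
  unfolding shatters_def
proof (intro allI impI)
  fix T assume "T \<subseteq> S"
  then obtain A where "A \<in> F" "A \<inter> S = T" by (rule shattersE[OF assms(1)])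
  then show "\<exists>A\<in>G. A \<inter> S = T" using assms(2) by auto
qed

text \<open>Split on one element \<open>x\<close>: \<open>F0\<close> holds the members avoiding
  \<open>x\<close>, \<open>F1\<close> the traces of those containing it. A set shattered by either
  is shattered by \<open>F\<close>; if both shatter \<open>S\<close>, then \<open>F\<close> also
  shatters \<open>insert x S\<close>, so \<open>S\<close> may be counted twice.\<close>

lemma card_le_card_shattered:
  assumes "finite X" "F \<subseteq> Pow X"
  shows "card F \<le> card {S. S \<subseteq> X \<and> shatters F S}"
  using assms
proof (induction X arbitrary: F rule: finite_induct)
  case empty
  then consider "F = {}" | "F = {{}}" by (auto simp: subset_singleton_iff)
  then show ?case
  proof cases
    case 2
    then have "{S. S \<subseteq> {} \<and> shatters F S} = {{}}" by (auto simp: shatters_def)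
    with 2 show ?thesis by simp
  qed simp
next
  case (insert x Y)
  define F0 where "F0 = {A\<in>F. x \<notin> A}"
  define F1 where "F1 = (\<lambda>A. A - {x}) ` {A\<in>F. x \<in> A}"
  define sh where "sh G = {S. S \<subseteq> Y \<and> shatters G S}" for G
  have sub: "F0 \<subseteq> Pow Y" "F1 \<subseteq> Pow Y" using insert.prems by (auto simp: F0_def F1_def)
  have finF: "finite F" using insert by (meson finite.insertI finite_Pow_iff finite_subset)
  have finsh: "finite (sh G)" for G using insert.hyps(1) by (simp add: sh_def)
  have inj: "inj_on (\<lambda>A. A - {x}) {A\<in>F. x \<in> A}" by (rule inj_onI) auto
  have "card F = card (F0 \<union> {A\<in>F. x \<in> A})" by (rule arg_cong[of _ _ card]) (auto simp: F0_def)
  also have "\<dots> = card F0 + card {A\<in>F. x \<in> A}"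
    using finF by (intro card_Un_disjoint) (auto simp: F0_def)
  also have "card {A\<in>F. x \<in> A} = card F1" unfolding F1_def by (rule card_image[OF inj, symmetric])
  also have "card F0 + card F1 \<le> card (sh F0) + card (sh F1)"
    using insert.IH[OF sub(1)] insert.IH[OF sub(2)] by (simp add: sh_def)
  \<comment> \<open>The doubly counted sets, those in the intersection, are traded below for their
    copies containing \<open>x\<close>.\<close>
  also have "\<dots> = card (sh F0 \<union> sh F1) + card (sh F0 \<inter> sh F1)"
    by (rule card_Un_Int[OF finsh finsh])
  also have "card (sh F0 \<inter> sh F1) = card (insert x ` (sh F0 \<inter> sh F1))"
  proof (rule card_image[symmetric], rule inj_onI)
    fix A B assume "A \<in> sh F0 \<inter> sh F1" "B \<in> sh F0 \<inter> sh F1" "insert x A = insert x B"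
    moreover from this have "x \<notin> A" "x \<notin> B" using insert.hyps(2) by (auto simp: sh_def)
    ultimately show "A = B" by (metis insert_ident)
  qed
  also have "card (sh F0 \<union> sh F1) + \<dots> = card (sh F0 \<union> sh F1 \<union> insert x ` (sh F0 \<inter> sh F1))"
    using finsh insert.hyps(2) by (intro card_Un_disjoint[symmetric]) (auto simp: sh_def)
  also have "\<dots> \<le> card {S. S \<subseteq> insert x Y \<and> shatters F S}"
  proof (rule card_mono)
    show "finite {S. S \<subseteq> insert x Y \<and> shatters F S}" using insert.hyps(1) by simp
    have sh: "shatters G S" if "S \<in> sh G" for S G using that by (simp add: sh_def)
    have "F0 \<subseteq> F" by (auto simp: F0_def)
    then have F0: "shatters F S" if "S \<in> sh F0" for S
      using sh[OF that] by (rule shatters_mono[rotated])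
    have F1: "shatters F S" if S: "S \<in> sh F1" for S
      unfolding shatters_def
    proof (intro allI impI)
      fix T assume "T \<subseteq> S"
      then obtain A where "A \<in> F1" "A \<inter> S = T" by (rule shattersE[OF sh[OF S]])
      from \<open>A \<in> F1\<close> obtain B where "B \<in> F" "A = B - {x}" unfolding F1_def by blast
      moreover have "x \<notin> S" using S insert.hyps(2) by (auto simp: sh_def)
      ultimately have "B \<inter> S = T" using \<open>A \<inter> S = T\<close> by blast
      with \<open>B \<in> F\<close> show "\<exists>A\<in>F. A \<inter> S = T" by blast
    qed
    have both: "shatters F (insert x S)" if S: "S \<in> sh F0" "S \<in> sh F1" for S
      unfolding shatters_def
    proof (intro allI impI)
      fix T assume T: "T \<subseteq> insert x S"
      have x: "x \<notin> S" using S insert.hyps(2) by (auto simp: sh_def)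
      show "\<exists>A\<in>F. A \<inter> insert x S = T"
      \<comment> \<open>A trace containing \<open>x\<close> is lifted from \<open>F1\<close>, a
        trace avoiding \<open>x\<close> is taken from \<open>F0\<close>.\<close>
      proof (cases "x \<in> T")
        case True
        have "T - {x} \<subseteq> S" using T by auto
        then obtain A where A: "A \<in> F1" "A \<inter> S = T - {x}" by (rule shattersE[OF sh[OF S(2)]])
        from A(1) obtain B where B: "B \<in> F" "x \<in> B" "A = B - {x}" unfolding F1_def by blast
        then have "B \<inter> insert x S = insert x (A \<inter> S)" using x by blast
        also have "\<dots> = T" using A(2) True by blast
        finally have "B \<inter> insert x S = T" .
        with \<open>B \<in> F\<close> show ?thesis by blast
      next
        case False
        then have "T \<subseteq> S" using T by auto
        then obtain A where A: "A \<in> F0" "A \<inter> S = T" by (rule shattersE[OF sh[OF S(1)]])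
        then have "A \<in> F" "x \<notin> A" by (auto simp: F0_def)
        with A(2) show ?thesis by blast
      qed
    qed
    show "sh F0 \<union> sh F1 \<union> insert x ` (sh F0 \<inter> sh F1) \<subseteq> {S. S \<subseteq> insert x Y \<and> shatters F S}"
    proof
      fix S assume "S \<in> sh F0 \<union> sh F1 \<union> insert x ` (sh F0 \<inter> sh F1)"
      then consider "S \<in> sh F0" | "S \<in> sh F1"
        | S' where "S = insert x S'" "S' \<in> sh F0" "S' \<in> sh F1" by blast
      then have "S \<subseteq> insert x Y \<and> shatters F S"
      proof cases
        case 1
        then show ?thesis using F0 by (auto simp: sh_def)
      next
        case 2
        then show ?thesis using F1 by (auto simp: sh_def)
      next
        case 3
        then show ?thesis using both by (auto simp: sh_def)
      qed
      then show "S \<in> {S. S \<subseteq> insert x Y \<and> shatters F S}" by simp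
    qed
  qed
  finally show ?case .
qed

section \<open>VC dimension of the sign patterns of a linear space\<close>

text \<open>A zero coordinate counts as positive.\<close>

definition sign_patterns :: "('b \<Rightarrow> 'a \<Rightarrow> real) \<Rightarrow> 'a set \<Rightarrow> 'b set \<Rightarrow> 'a set set" where
  "sign_patterns M X I = range (\<lambda>f. {j\<in>X. 0 \<le> (\<Sum>i\<in>I. f i * M i j)})"

text \<open>The combinations of the rows in \<open>I\<close>, restricted to \<open>S\<close>, span
  dimension at most \<open>card I\<close>. If \<open>S\<close> were larger, some nonzero
  \<open>c\<close> would be orthogonal to all of them, and its own sign pattern could not
  occur.\<close>

lemma card_shattered_by_sign_patterns:
  assumes "finite I" "finite X" "S \<subseteq> X" "shatters (sign_patterns M X I) S"
  shows "card S \<le> card I"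
proof (rule ccontr)
  assume "\<not> ?thesis"
  moreover have S: "finite S" using assms(2,3) by (rule finite_subset[rotated])
  ultimately obtain c0 where c0: "\<exists>j\<in>S. c0 j \<noteq> 0"
      "\<forall>i\<in>I. (\<Sum>j\<in>S. c0 j * M i j) = 0"
    using exists_dependency[of I S "\<lambda>j i. M i j"] assms(1) by auto
  \<comment> \<open>Zero counts as positive, so only a negative entry of \<open>c\<close> forces a
    nonzero value of the matching combination, and with it a strictly positive product. Negating
    \<open>c0\<close> if necessary supplies such an entry.\<close>
  obtain c where c: "\<exists>j\<in>S. c j < 0" "\<forall>i\<in>I. (\<Sum>j\<in>S. c j * M i j) = 0"
  proof (cases "\<exists>j\<in>S. c0 j < 0")
    case True
    then show ?thesis using that c0 by blast
  next
    case False
    then have "\<exists>j\<in>S. - c0 j < 0" using c0(1) by (metis neg_less_0_iff_less linorder_neqE)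
    then show ?thesis using c0(2) that[of "\<lambda>j. - c0 j"] by (auto simp: sum_negf)
  qed
  txt \<open>A combination whose sign pattern on \<open>S\<close> is that of the dependency \<open>c\<close> cannot be orthogonal to \<open>c\<close>.\<close>
  have "{j\<in>S. 0 \<le> c j} \<subseteq> S" by auto
  then obtain A where A: "A \<in> sign_patterns M X I" "A \<inter> S = {j\<in>S. 0 \<le> c j}"
    by (rule shattersE[OF assms(4)])
  then obtain f where f: "{j\<in>X. 0 \<le> (\<Sum>i\<in>I. f i * M i j)} \<inter> S = {j\<in>S. 0 \<le> c j}"
    by (auto simp: sign_patterns_def)
  define g where "g j = (\<Sum>i\<in>I. f i * M i j)" for j
  have g: "0 \<le> g j \<longleftrightarrow> 0 \<le> c j" if "j \<in> S" for j
    using f that assms(3) unfolding g_def by blast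
  have "(\<Sum>j\<in>S. c j * g j) = (\<Sum>i\<in>I. f i * (\<Sum>j\<in>S. c j * M i j))"
    unfolding g_def sum_distrib_left by (subst sum.swap) (simp add: mult_ac)
  also have "\<dots> = 0" using c(2) by simp
  finally have 0: "(\<Sum>j\<in>S. c j * g j) = 0" .
  obtain j0 where j0: "j0 \<in> S" "c j0 < 0" using c(1) by blast
  have "0 < (\<Sum>j\<in>S. c j * g j)"
  proof (rule sum_pos2[OF S j0(1)])
    show "0 < c j0 * g j0" using g[OF j0(1)] j0(2) by (simp add: mult_neg_neg)
    show "0 \<le> c j * g j" if "j \<in> S" for j
      using g[OF that] by (cases "0 \<le> c j") (auto intro: mult_nonpos_nonpos)
  qed
  with 0 show False by simp
qed

section \<open>Counting supports, patterns and Hamming balls\<close>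

definition small_subsets :: "'a set \<Rightarrow> nat \<Rightarrow> 'a set set" where
  "small_subsets X m = {S. S \<subseteq> X \<and> card S \<le> m}"

lemma finite_small_subsets: "finite X \<Longrightarrow> finite (small_subsets X m)"
  by (simp add: small_subsets_def)

lemma card_sign_patterns:
  assumes "finite I" "finite X" "card I \<le> m"
  shows "card (sign_patterns M X I) \<le> card (small_subsets X m)"
proof -
  have "card (sign_patterns M X I) \<le> card {S. S \<subseteq> X \<and> shatters (sign_patterns M X I) S}"
    using assms(2) by (rule card_le_card_shattered) (auto simp: sign_patterns_def)
  also have "\<dots> \<le> card (small_subsets X m)"
  proof (rule card_mono[OF finite_small_subsets[OF assms(2)]])
    show "{S. S \<subseteq> X \<and> shatters (sign_patterns M X I) S} \<subseteq> small_subsets X m"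
    proof safe
      fix S assume "S \<subseteq> X" "shatters (sign_patterns M X I) S"
      then have "card S \<le> card I" by (rule card_shattered_by_sign_patterns[OF assms(1,2)])
      then show "S \<in> small_subsets X m"
        using assms(3) \<open>S \<subseteq> X\<close> by (simp add: small_subsets_def)
    qed
  qed
  finally show ?thesis .
qed

text \<open>Chernoff-style weighting: the weight \<open>16 ^ m * (1 / 16) ^ card S\<close> is at
  least 1 on the sets counted, and its sum over all subsets factors into a product over
  \<open>X\<close>.\<close>

lemma card_small_subsets_le:
  assumes "finite X"
  shows "real (card (small_subsets X m)) \<le> 16 ^ m * (17 / 16) ^ card X"
proof -
  have "real (card (small_subsets X m)) = (\<Sum>S\<in>small_subsets X m. 1)" by simp
  also have "\<dots> \<le> (\<Sum>S\<in>small_subsets X m. 16 ^ m * (1 / 16) ^ card S)"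
  proof (rule sum_mono)
    fix S assume "S \<in> small_subsets X m"
    then have "(16::real) ^ card S \<le> 16 ^ m"
      by (intro power_increasing) (auto simp: small_subsets_def)
    then show "(1::real) \<le> 16 ^ m * (1 / 16) ^ card S" by (simp add: power_one_over field_simps)
  qed
  also have "\<dots> \<le> (\<Sum>S\<in>Pow X. 16 ^ m * (1 / 16) ^ card S)"
    using assms by (intro sum_mono2) (auto simp: small_subsets_def)
  also have "\<dots> = 16 ^ m * (\<Sum>S\<in>Pow X. (\<Prod>x\<in>S. 1 / 16) * (\<Prod>x\<in>X - S. 1))"
    by (simp add: sum_distrib_left)
  also have "\<dots> = 16 ^ m * (\<Prod>x\<in>X. 1 / 16 + 1)"
    by (subst prod_add[OF assms]) simp
  finally show ?thesis by simp
qed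

text \<open>The cube provides one factor each for supports, sign patterns and ball size. Squaring it
  turns \<open>16 ^ m\<close> into \<open>2 ^ (24 * m)\<close>, which matches the hypothesis on
  \<open>m\<close> without fractional exponents.\<close>

lemma card_small_subsets_cubed:
  assumes "finite X" "24 * m \<le> card X" "0 < card X"
  shows "card (small_subsets X m) ^ 3 < 2 ^ card X"
proof -
  let ?B = "real (card (small_subsets X m))" and ?n = "card X"
  have "(?B ^ 3) ^ 2 = ?B ^ 6" by simp
  also have "\<dots> \<le> (16 ^ m * (17 / 16) ^ ?n) ^ 6"
    by (intro power_mono card_small_subsets_le assms) simp
  also have "\<dots> = 2 ^ (24 * m) * ((17 / 16) ^ 6) ^ ?n"
  proof -
    have "((16::real) ^ m) ^ 6 = (16 ^ 6) ^ m" by (simp only: mult.commute flip: power_mult)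
    also have "\<dots> = 2 ^ (24 * m)" by (simp add: power_mult)
    finally show ?thesis 
      by (simp only: power_mult_distrib) (simp only: mult.commute[of _ 6] flip: power_mult)
  qed
  also have "\<dots> \<le> 2 ^ ?n * ((17 / 16) ^ 6) ^ ?n"
    using assms(2) by (intro mult_right_mono power_increasing) auto
  also have "\<dots> = (2 * (17 / 16) ^ 6) ^ ?n" by (rule power_mult_distrib[symmetric])
  \<comment> \<open>Here \<open>(17 / 16) ^ 6\<close> is about 1.44, hence below 2.\<close>
  also have "\<dots> < (2 ^ 2) ^ ?n" using assms(3) by (intro power_strict_mono) (simp_all add: power_divide)
  also have "\<dots> = (2 ^ ?n) ^ 2" by (simp only: mult.commute flip: power_mult)
  finally have "?B ^ 3 < 2 ^ ?n" by (rule power_less_imp_less_base) simp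
  then have "real (card (small_subsets X m) ^ 3) < real (2 ^ ?n)" by simp
  then show ?thesis by (rule of_nat_less_imp_less)
qed

text \<open>Symmetric difference with \<open>T\<close> carries the ball around \<open>T\<close>
  injectively into the ball around the empty set.\<close>

lemma card_hamming_ball:
  assumes "finite X" "T \<subseteq> X"
  shows "card {S. S \<subseteq> X \<and> card (sym_diff S T) \<le> m} \<le> card (small_subsets X m)"
proof (rule card_inj_on_le[OF _ _ finite_small_subsets[OF assms(1)]])
  show "inj_on (\<lambda>S. sym_diff S T) {S. S \<subseteq> X \<and> card (sym_diff S T) \<le> m}"
    by (rule inj_onI) blast
  show "(\<lambda>S. sym_diff S T) ` {S. S \<subseteq> X \<and> card (sym_diff S T) \<le> m} \<subseteq> small_subsets X m"
    using assms(2) by (auto simp: small_subsets_def)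
qed

text \<open>Union bound: otherwise the balls of radius \<open>m\<close> around all patterns would
  cover \<open>Pow X\<close>. Sparsity and radius share the bound \<open>m\<close>, so one
  cardinality bounds all three factors. The set \<open>S\<close> is chosen before \<open>I\<close>
  and \<open>T\<close>, so a single one serves every sparse inequality.\<close>

lemma exists_set_far_from_sign_patterns:
  fixes M :: "'a \<Rightarrow> 'a \<Rightarrow> real"
  assumes X: "finite X" "0 < card X" "24 * m \<le> card X"
  shows "\<exists>S\<subseteq>X. \<forall>I\<in>small_subsets X m. \<forall>T\<in>sign_patterns M X I. m < card (sym_diff S T)"
proof (rule ccontr)
  assume none: "\<not> ?thesis"
  define ball where "ball T = {S. S \<subseteq> X \<and> card (sym_diff S T) \<le> m}" for T
  let ?\<S> = "small_subsets X m"
  have "Pow X \<subseteq> (\<Union>I\<in>?\<S>. \<Union>T\<in>sign_patterns M X I. ball T)"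
    using none unfolding ball_def by (fastforce simp: not_less)
  moreover have fin: "finite (sign_patterns M X I)" for I
    by (rule finite_subset[of _ "Pow X"]) (use X(1) in \<open>auto simp: sign_patterns_def\<close>)
  moreover have "finite (ball T)" for T using X(1) by (simp add: ball_def)
  ultimately have "card (Pow X) \<le> card (\<Union>I\<in>?\<S>. \<Union>T\<in>sign_patterns M X I. ball T)"
    using finite_small_subsets[OF X(1)] by (intro card_mono) auto
  also have "\<dots> \<le> (\<Sum>I\<in>?\<S>. card (\<Union>T\<in>sign_patterns M X I. ball T))"
    by (intro card_UN_le finite_small_subsets X)
  also have "\<dots> \<le> (\<Sum>I\<in>?\<S>. card ?\<S> * card ?\<S>)"
  proof (rule sum_mono)
    fix I assume I: "I \<in> ?\<S>"
    have "card (\<Union>T\<in>sign_patterns M X I. ball T) \<le> (\<Sum>T\<in>sign_patterns M X I. card (ball T))"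
      by (intro card_UN_le fin)
    also have "\<dots> \<le> (\<Sum>T\<in>sign_patterns M X I. card ?\<S>)"
      unfolding ball_def using X(1)
      by (intro sum_mono card_hamming_ball) (auto simp: sign_patterns_def)
    also have "\<dots> \<le> card ?\<S> * card ?\<S>"
      using I X(1) by (auto simp: small_subsets_def intro: finite_subset card_sign_patterns[unfolded small_subsets_def])
    finally show "card (\<Union>T\<in>sign_patterns M X I. ball T) \<le> card ?\<S> * card ?\<S>" .
  qed
  also have "\<dots> = card ?\<S> ^ 3" by (simp add: power3_eq_cube)
  also have "\<dots> < 2 ^ card X" using X by (intro card_small_subsets_cubed)
  finally show False using X(1) by (simp add: card_Pow)
qed

section \<open>Sums of the largest entries\<close>

lemma exists_top_subset:
  fixes g :: "'a \<Rightarrow> real"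
  assumes "finite X" "h \<le> card X"
  shows "\<exists>T\<subseteq>X. card T = h \<and> (\<forall>i\<in>T. \<forall>j\<in>X - T. g j \<le> g i)"
  using assms(2)
proof (induction h)
  case 0
  then show ?case by (intro exI[of _ "{}"]) auto
next
  case (Suc h)
  then obtain T where T: "T \<subseteq> X" "card T = h" "\<forall>i\<in>T. \<forall>j\<in>X - T. g j \<le> g i" by auto
  have "finite T" using T(1) assms(1) by (rule finite_subset)
  have "X - T \<noteq> {}" using T Suc.prems by auto
  then have "Max (g ` (X - T)) \<in> g ` (X - T)" using assms(1) by (intro Max_in) auto
  then obtain p where p: "p \<in> X - T" "g p = Max (g ` (X - T))" by auto
  then have p_max: "g j \<le> g p" if "j \<in> X - T" for j
    using that assms(1) by simp
  show ?case
  proof (intro exI[of _ "insert p T"] conjI ballI)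
    show "insert p T \<subseteq> X" using T p by auto
    show "card (insert p T) = Suc h" using T p \<open>finite T\<close> by auto
    fix i j assume "i \<in> insert p T" "j \<in> X - insert p T"
    then show "g j \<le> g i" using T(3) p_max by auto
  qed
qed

text \<open>The full sum approaches twice the sum over \<open>T\<close> only when \<open>g\<close>
  is nearly constant, and then flipping the signs on \<open>D\<close> costs a fixed proportion.
  Truncating \<open>g\<close> at \<open>t\<close>, its least value on \<open>T\<close>, makes this
  precise.\<close>

lemma flipped_sum_le_top_sum:
  fixes g :: "'a \<Rightarrow> real" and \<delta> :: real
  assumes X: "finite X" "card X = 2 * h" "0 < h" and g: "\<And>i. i \<in> X \<Longrightarrow> 0 \<le> g i"
    and T: "T \<subseteq> X" "card T = h" "\<forall>i\<in>T. \<forall>j\<in>X - T. g j \<le> g i"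
    and D: "D \<subseteq> X" "\<delta> * card X \<le> card D" and \<delta>: "\<delta> \<le> 1 / 2"
  shows "(\<Sum>i\<in>X. g i) - 2 * (\<Sum>i\<in>D. g i) \<le> 2 * (1 - \<delta>) * (\<Sum>i\<in>T. g i)"
proof -
  have finT: "finite T" and finD: "finite D" using T D X(1) by (auto intro: finite_subset)
  define t where "t = Min (g ` T)"
  have T0: "T \<noteq> {}" using T(2) X(3) by auto
  have t1: "t \<le> g i" if "i \<in> T" for i using that finT by (simp add: t_def)
  have "t \<in> g ` T" unfolding t_def using finT T0 by (intro Min_in) auto
  then have t2: "g j \<le> t" if "j \<in> X - T" for j using T that by auto
  have t0: "0 \<le> t" using \<open>t \<in> g ` T\<close> T g by auto
  let ?\<tau> = "\<Sum>i\<in>T. g i" and ?\<beta> = "\<Sum>i\<in>X - T. g i"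
  have sX: "(\<Sum>i\<in>X. g i) = ?\<tau> + ?\<beta>" using X(1) T(1) by (simp add: sum.subset_diff)
  have "?\<tau> \<ge> (\<Sum>i\<in>T. t)" by (intro sum_mono t1)
  then have \<tau>: "h * t \<le> ?\<tau>" using T(2) by simp
  \<comment> \<open>Truncation fixes the values outside \<open>T\<close> and flattens those on
    \<open>T\<close> to \<open>t\<close>. The truncated total is then split a second time, along
    \<open>D\<close>.\<close>
  have "?\<beta> + t * h = (\<Sum>i\<in>X - T. min (g i) t) + (\<Sum>i\<in>T. min (g i) t)"
  proof -
    have "(\<Sum>i\<in>T. min (g i) t) = (\<Sum>i\<in>T. t)" by (intro sum.cong) (auto simp: t1 min_absorb2)
    moreover have "(\<Sum>i\<in>X - T. min (g i) t) = ?\<beta>" by (intro sum.cong) (use t2 in auto)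
    ultimately show ?thesis using T(2) by simp
  qed
  also have "\<dots> = (\<Sum>i\<in>X. min (g i) t)" using X(1) T(1) by (simp add: sum.subset_diff)
  also have "\<dots> = (\<Sum>i\<in>X - D. min (g i) t) + (\<Sum>i\<in>D. min (g i) t)"
    using X(1) D(1) by (simp add: sum.subset_diff)
  also have "\<dots> \<le> (\<Sum>i\<in>X - D. t) + (\<Sum>i\<in>D. g i)" by (intro add_mono sum_mono) auto
  also have "(\<Sum>i\<in>X - D. t) = (2 * real h - card D) * t"
    using X D finD card_mono[OF X(1) D(1)] by (simp add: card_Diff_subset of_nat_diff)
  also have "\<dots> \<le> (2 * real h - \<delta> * (2 * real h)) * t"
    using D(2) X(2) t0 by (intro mult_right_mono) auto
  finally have a: "?\<beta> - (1 - 2 * \<delta>) * (h * t) \<le> (\<Sum>i\<in>D. g i)" by (simp add: algebra_simps)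
  have "(1 - 2 * \<delta>) * (h * t) \<le> (1 - 2 * \<delta>) * ?\<tau>"
    using \<tau> \<delta> by (intro mult_left_mono) auto
  txt \<open>The claim is the average of the bound from \<open>a\<close> and the trivial bound by the sum over \<open>X\<close>.\<close>
  moreover have "0 \<le> (\<Sum>i\<in>D. g i)" using D(1) g by (intro sum_nonneg) auto
  ultimately show ?thesis using a unfolding sX by (simp add: algebra_simps)
qed

section \<open>The symmetrized budget polytope\<close>

lemma convex_vec_set_l1_ball:
  "convex_vec_set n {x \<in> carrier_vec n. (\<Sum>i<n. \<bar>x $ i\<bar>) \<le> (r::real)}"
  unfolding convex_vec_set_def
proof (intro conjI ballI allI impI)
  fix x y :: "real vec" and u v :: real
  assume x: "x \<in> {x \<in> carrier_vec n. (\<Sum>i<n. \<bar>x $ i\<bar>) \<le> r}"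
    and y: "y \<in> {x \<in> carrier_vec n. (\<Sum>i<n. \<bar>x $ i\<bar>) \<le> r}"
    and uv: "0 \<le> u" "0 \<le> v" "u + v = 1"
  have "(\<Sum>i<n. \<bar>(u \<cdot>\<^sub>v x + v \<cdot>\<^sub>v y) $ i\<bar>) \<le> (\<Sum>i<n. u * \<bar>x $ i\<bar> + v * \<bar>y $ i\<bar>)"
  proof (rule sum_mono)
    fix i assume "i \<in> {..<n}"
    then have "(u \<cdot>\<^sub>v x + v \<cdot>\<^sub>v y) $ i = u * x $ i + v * y $ i" using x y by auto
    also have "\<bar>\<dots>\<bar> \<le> \<bar>u * x $ i\<bar> + \<bar>v * y $ i\<bar>" by (rule abs_triangle_ineq)
    finally show "\<bar>(u \<cdot>\<^sub>v x + v \<cdot>\<^sub>v y) $ i\<bar> \<le> u * \<bar>x $ i\<bar> + v * \<bar>y $ i\<bar>"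
      using uv by (simp add: abs_mult)
  qed
  also have "\<dots> = u * (\<Sum>i<n. \<bar>x $ i\<bar>) + v * (\<Sum>i<n. \<bar>y $ i\<bar>)"
    by (simp add: sum.distrib sum_distrib_left)
  also have "\<dots> \<le> u * r + v * r" using x y uv by (intro add_mono mult_left_mono) auto
  also have "\<dots> = r" using uv by (simp flip: distrib_right)
  finally show "u \<cdot>\<^sub>v x + v \<cdot>\<^sub>v y \<in> {x \<in> carrier_vec n. (\<Sum>i<n. \<bar>x $ i\<bar>) \<le> r}"
    using x y by auto
qed auto

text \<open>The l1 ball of radius \<open>t\<close> is convex, and reflections preserve the l1 norm.
  This outer bound is what separates the far point from the polytope.\<close>

lemma symmetrized_budget_subset:
  "symmetrized n (budget_polytope t n) \<subseteq> {x \<in> carrier_vec n. (\<Sum>i<n. \<bar>x $ i\<bar>) \<le> t}"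
  unfolding symmetrized_def conv_vec_def
proof (rule hull_minimal)
  show "convex_vec_set n {x \<in> carrier_vec n. (\<Sum>i<n. \<bar>x $ i\<bar>) \<le> t}" by (rule convex_vec_set_l1_ball)
next
  show "(\<Union>I\<in>Pow {..<n}. reflect_vec n I ` budget_polytope t n)
    \<subseteq> {x \<in> carrier_vec n. (\<Sum>i<n. \<bar>x $ i\<bar>) \<le> t}"
  proof safe
    fix I x assume x: "x \<in> budget_polytope t n"
    show "reflect_vec n I x \<in> carrier_vec n" by (simp add: reflect_vec_def)
    have "(\<Sum>i<n. \<bar>reflect_vec n I x $ i\<bar>) = (\<Sum>i<n. x $ i)"
      using x by (intro sum.cong) (auto simp: reflect_vec_def budget_polytope_def)
    then show "(\<Sum>i<n. \<bar>reflect_vec n I x $ i\<bar>) \<le> t" using x by (simp add: budget_polytope_def)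
  qed
qed

text \<open>A reflection of the indicator of \<open>T\<close> gives this point. Its inner product
  with \<open>b\<close> is the sum of the absolute values of \<open>b\<close> over
  \<open>T\<close>.\<close>

lemma signed_indicator_in_symmetrized_budget:
  fixes b :: "nat \<Rightarrow> real"
  assumes "T \<subseteq> {..<n}" "real (card T) \<le> t"
  shows "vec n (\<lambda>i. if i \<in> T then if 0 \<le> b i then 1 else - 1 else 0)
    \<in> symmetrized n (budget_polytope t n)"
proof -
  define I where "I = {i\<in>{..<n}. 0 \<le> b i}"
  define x :: "real vec" where "x = vec n (\<lambda>i. if i \<in> T then 1 else 0)"
  have "(\<Sum>i<n. x $ i) = (\<Sum>i\<in>{..<n}. if i \<in> T then 1 else 0)" by (simp add: x_def)
  also have "\<dots> = card T" using assms(1) by (simp add: Int_absorb1 flip: sum.inter_restrict)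
  finally have "x \<in> budget_polytope t n"
    using assms(2) by (simp add: budget_polytope_def) (simp add: x_def)
  moreover have "vec n (\<lambda>i. if i \<in> T then if 0 \<le> b i then 1 else - 1 else 0) = reflect_vec n I x"
    by (intro eq_vecI) (auto simp: reflect_vec_def x_def I_def)
  ultimately show ?thesis
    unfolding symmetrized_def conv_vec_def by (intro hull_inc) (auto simp: I_def)
qed

lemma symmetrized_budget_support:
  fixes b :: "nat \<Rightarrow> real"
  assumes "n = 2 * h" "0 < h" and S: "S \<subseteq> {..<n}"
    and far: "n \<le> 24 * card (sym_diff S {j\<in>{..<n}. 0 \<le> b j})"
  obtains x where "x \<in> symmetrized n (budget_polytope (real n / 2) n)"
    "(25 / 48) * (\<Sum>i<n. b i * (if i \<in> S then 1 else - 1)) \<le> (\<Sum>i<n. b i * x $ i)"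
proof -
  define D where "D = sym_diff S {j\<in>{..<n}. 0 \<le> b j}"
  have D: "D \<subseteq> {..<n}" using S by (auto simp: D_def)
  have "h \<le> card {..<n}" using assms by simp
  from exists_top_subset[OF finite_lessThan this, of "\<lambda>i. \<bar>b i\<bar>"]
  obtain T where T: "T \<subseteq> {..<n}" "card T = h" "\<forall>i\<in>T. \<forall>j\<in>{..<n} - T. \<bar>b j\<bar> \<le> \<bar>b i\<bar>" by blast
  define x where "x = vec n (\<lambda>i. if i \<in> T then if 0 \<le> b i then 1 else - 1 else (0::real))"
  have x: "x \<in> symmetrized n (budget_polytope (real n / 2) n)"
    unfolding x_def by (rule signed_indicator_in_symmetrized_budget) (use T assms in auto)
  have "(\<Sum>i<n. b i * x $ i) = (\<Sum>i\<in>{..<n}. if i \<in> T then \<bar>b i\<bar> else 0)"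
    by (intro sum.cong) (auto simp: x_def)
  also have "\<dots> = (\<Sum>i\<in>T. \<bar>b i\<bar>)" using T(1) by (simp add: Int_absorb1 flip: sum.inter_restrict)
  finally have top: "(\<Sum>i<n. b i * x $ i) = (\<Sum>i\<in>T. \<bar>b i\<bar>)" .
  \<comment> \<open>Agreement of \<open>S\<close> with the sign of \<open>b i\<close> contributes
    the absolute value of \<open>b i\<close>, disagreement its negative, a loss of twice that
    value.\<close>
  have "(\<Sum>i<n. b i * (if i \<in> S then 1 else - 1))
      = (\<Sum>i<n. \<bar>b i\<bar> - (if i \<in> D then 2 * \<bar>b i\<bar> else 0))"
    by (intro sum.cong) (auto simp: D_def)
  also have "\<dots> = (\<Sum>i<n. \<bar>b i\<bar>) - 2 * (\<Sum>i\<in>D. \<bar>b i\<bar>)"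
    using D by (simp add: sum_subtractf Int_absorb1 sum_distrib_left flip: sum.inter_restrict)
  also have "\<dots> \<le> 2 * (1 - 1 / 24) * (\<Sum>i\<in>T. \<bar>b i\<bar>)"
  proof (rule flipped_sum_le_top_sum[OF finite_lessThan _ \<open>0 < h\<close> _ T D])
    show "1 / 24 * real (card {..<n}) \<le> real (card D)" using far unfolding D_def[symmetric] by simp
  qed (use assms(1) in auto)
  finally have "(\<Sum>i<n. b i * (if i \<in> S then 1 else - 1)) \<le> (23 / 12) * (\<Sum>i\<in>T. \<bar>b i\<bar>)" by simp
  moreover have "0 \<le> (\<Sum>i\<in>T. \<bar>b i\<bar>)" by (rule sum_nonneg) auto
  \<comment> \<open>The scaling is admissible because
    \<open>(25 / 48) * (23 / 12) = 575 / 576\<close> is below 1.\<close>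
  ultimately show thesis using that[OF x] unfolding top by linarith
qed

section \<open>Norms and distances\<close>

text \<open>Cauchy-Schwarz against the constant vector \<open>c\<close>, obtained by expanding a sum
  of squares.\<close>

lemma sqrt_mult_le_l2_norm_vec:
  assumes x: "x \<in> carrier_vec n" and c: "0 \<le> c" "c * n \<le> (\<Sum>i<n. \<bar>x $ i\<bar>)"
  shows "c * sqrt n \<le> l2_norm_vec x"
proof -
  have "0 \<le> (\<Sum>i<n. (\<bar>x $ i\<bar> - c)\<^sup>2)" by (rule sum_nonneg) simp
  also have "\<dots> = (\<Sum>i<n. (x $ i)\<^sup>2) - 2 * c * (\<Sum>i<n. \<bar>x $ i\<bar>) + n * c\<^sup>2"
    by (simp add: power2_diff sum.distrib sum_subtractf sum_distrib_left mult_ac)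
  also have "(\<Sum>i<n. (x $ i)\<^sup>2) = x \<bullet> x"
    using x by (simp add: scalar_prod_def power2_eq_square atLeast0LessThan)
  finally have "c * (2 * (\<Sum>i<n. \<bar>x $ i\<bar>)) \<le> x \<bullet> x + n * c\<^sup>2" by (simp add: mult_ac)
  moreover have "c * (2 * (c * n)) \<le> c * (2 * (\<Sum>i<n. \<bar>x $ i\<bar>))"
    using c by (intro mult_left_mono) auto
  ultimately have "(c * sqrt n)\<^sup>2 \<le> x \<bullet> x"
    by (simp add: power_mult_distrib) (simp add: power2_eq_square mult_ac)
  then show ?thesis unfolding l2_norm_vec_def by (rule real_le_rsqrt)
qed

lemma l2_norm_vec_orthogonal:
  assumes "A \<in> carrier_mat n n" "transpose_mat A * A = 1\<^sub>m n" "x \<in> carrier_vec n"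
  shows "l2_norm_vec (A *\<^sub>v x) = l2_norm_vec x"
proof -
  have "(A *\<^sub>v x) \<bullet> (A *\<^sub>v x) = (transpose_mat A *\<^sub>v (A *\<^sub>v x)) \<bullet> x"
    using assms by (intro transpose_vec_mult_scalar[symmetric]) auto
  also have "transpose_mat A *\<^sub>v (A *\<^sub>v x) = (transpose_mat A * A) *\<^sub>v x"
    using assms by (intro assoc_mult_mat_vec[symmetric]) auto
  also have "\<dots> = x" using assms by simp
  finally show ?thesis by (simp add: l2_norm_vec_def)
qed

lemma l2_norm_vec_le_l1:
  assumes "x \<in> carrier_vec n"
  shows "l2_norm_vec x \<le> (\<Sum>i<n. \<bar>x $ i\<bar>)"
proof -
  have "x \<bullet> x = (\<Sum>i<n. \<bar>x $ i\<bar> * \<bar>x $ i\<bar>)"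
    using assms by (simp add: scalar_prod_def atLeast0LessThan)
  also have "\<dots> \<le> (\<Sum>i<n. \<bar>x $ i\<bar> * (\<Sum>j<n. \<bar>x $ j\<bar>))"
    by (intro sum_mono mult_left_mono member_le_sum) auto
  also have "\<dots> = (\<Sum>i<n. \<bar>x $ i\<bar>)\<^sup>2" by (simp add: power2_eq_square sum_distrib_right)
  finally show ?thesis unfolding l2_norm_vec_def by (intro real_le_lsqrt sum_nonneg) auto
qed

text \<open>The bounds on single coordinates are 1-sparse, so they persist in the closure. This
  makes the supremum in \<open>poly_dist\<close> meaningful.\<close>

lemma sparse_closure_bounded:
  assumes "0 < k" and P: "P \<subseteq> carrier_vec n" "\<And>x i. x \<in> P \<Longrightarrow> i < n \<Longrightarrow> \<bar>x $ i\<bar> \<le> r"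
    and x: "x \<in> sparse_closure n k P"
  shows "l2_norm_vec x \<le> n * r"
proof -
  have xc: "x \<in> carrier_vec n" using x by (simp add: sparse_closure_def)
  have "\<bar>x $ i\<bar> \<le> r" if i: "i < n" for i
  proof -
    have "s * x $ i \<le> r" if s: "\<bar>s\<bar> = 1" for s :: real
    proof -
      let ?a = "s \<cdot>\<^sub>v unit_vec n i"
      have a: "?a \<bullet> y = s * y $ i" if "y \<in> carrier_vec n" for y
        using that i by simp
      have "{j. j < dim_vec ?a \<and> ?a $ j \<noteq> 0} \<subseteq> {i}" by (auto simp: unit_vec_def split: if_splits)
      then have "card {j. j < dim_vec ?a \<and> ?a $ j \<noteq> 0} \<le> card {i}" by (intro card_mono) auto
      then have "sparse_vec k ?a" using assms(1) by (simp add: sparse_vec_def)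
      moreover have "valid_ineq ?a r P"
        unfolding valid_ineq_def
      proof
        fix y assume y: "y \<in> P"
        have "s * y $ i \<le> \<bar>s * y $ i\<bar>" by simp
        also have "\<dots> \<le> r" using P(2)[OF y i] s by (simp add: abs_mult)
        also have "s * y $ i = ?a \<bullet> y" using y P(1) by (intro a[symmetric]) auto
        finally show "?a \<bullet> y \<le> r" .
      qed
      moreover have "?a \<in> carrier_vec n" by simp
      ultimately have "?a \<bullet> x \<le> r" using x unfolding sparse_closure_def by blast
      then show ?thesis using a[OF xc] by simp
    qed
    from this[of 1] this[of "- 1"] show ?thesis by auto
  qed
  then have "(\<Sum>i<n. \<bar>x $ i\<bar>) \<le> (\<Sum>i<n. r)" by (intro sum_mono) simp
  then show ?thesis using l2_norm_vec_le_l1[OF xc] by simp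
qed

lemma abs_index_le_l2_norm_vec:
  assumes "x \<in> carrier_vec n" "i < n"
  shows "\<bar>x $ i\<bar> \<le> l2_norm_vec x"
proof -
  have "(x $ i)\<^sup>2 \<le> (\<Sum>j<n. (x $ j)\<^sup>2)" using assms(2) by (intro member_le_sum) auto
  also have "\<dots> = x \<bullet> x"
    using assms(1) by (simp add: scalar_prod_def power2_eq_square atLeast0LessThan)
  finally show ?thesis unfolding l2_norm_vec_def by (intro real_le_rsqrt) simp
qed

text \<open>Real suprema and infima are informative only for nonempty bounded sets:
  \<open>y0\<close> makes \<open>P\<close> nonempty, and its distances bound every infimum by
  \<open>B\<close>.\<close>

lemma poly_dist_ge:
  assumes x: "x \<in> Q" "\<And>y. y \<in> P \<Longrightarrow> r \<le> l2_norm_vec (x - y)"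
    and bdd: "y0 \<in> P" "\<And>x. x \<in> Q \<Longrightarrow> l2_norm_vec (x - y0) \<le> B"
  shows "r \<le> poly_dist P Q"
  unfolding poly_dist_def
proof (rule cSUP_upper2[OF _ x(1)])
  have nonneg: "0 \<le> l2_norm_vec z" for z
    by (simp add: l2_norm_vec_def scalar_prod_def sum_nonneg)
  then have below: "bdd_below ((\<lambda>y. l2_norm_vec (x - y)) ` P)" for x by (intro bdd_belowI2)
  show "bdd_above ((\<lambda>x. INF y\<in>P. l2_norm_vec (x - y)) ` Q)"
    by (rule bdd_aboveI2[of _ _ B]) (rule cINF_lower2[OF below bdd])
  show "r \<le> (INF y\<in>P. l2_norm_vec (x - y))" using bdd(1) x(2) by (intro cINF_greatest) auto
qed

section \<open>The distance bound\<close>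

text \<open>A functional \<open>a\<close> on the image acts on the polytope as \<open>b\<close>, the
  transpose of \<open>A\<close> applied to \<open>a\<close>. For sparse \<open>a\<close> this
  combines few rows of \<open>A\<close>, so a sign set far from all such patterns satisfies every
  sparse valid inequality at once.\<close>

lemma signed_point_in_sparse_closure:
  assumes n: "n = 2 * h" "0 < h" and k: "24 * k \<le> n" and A: "A \<in> carrier_mat n n"
  obtains y where "y \<in> carrier_vec n" "\<And>i. i < n \<Longrightarrow> \<bar>y $ i\<bar> = 25 / 48"
    "A *\<^sub>v y \<in> sparse_closure n k ((*\<^sub>v) A ` symmetrized n (budget_polytope (real n / 2) n))"
proof -
  let ?P = "symmetrized n (budget_polytope (real n / 2) n)"
  define m where "m = n div 24"
  have m: "24 * m \<le> card {..<n}" "0 < card {..<n}" using n by (auto simp: m_def)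
  from exists_set_far_from_sign_patterns[OF finite_lessThan m(2,1), of "\<lambda>i j. A $$ (i, j)"]
  obtain S where S: "S \<subseteq> {..<n}" and far:
    "\<And>I T. I \<in> small_subsets {..<n} m \<Longrightarrow> T \<in> sign_patterns (\<lambda>i j. A $$ (i, j)) {..<n} I
      \<Longrightarrow> m < card (sym_diff S T)"
    by blast
  \<comment> \<open>The factor is \<open>1 / 2 + 1 / 48\<close>: large enough to push the l1 norm of
    \<open>y\<close> beyond \<open>n / 2\<close>, small enough for the support bound.\<close>
  define y where "y = vec n (\<lambda>i. 25 / 48 * (if i \<in> S then 1 else - 1 :: real))"
  have y: "y \<in> carrier_vec n" by (simp add: y_def)
  have PC: "?P \<subseteq> carrier_vec n" using symmetrized_budget_subset by blast
  have "A *\<^sub>v y \<in> sparse_closure n k ((*\<^sub>v) A ` ?P)"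
    unfolding sparse_closure_def
  proof (safe)
    show "A *\<^sub>v y \<in> carrier_vec n" using A y by simp
    fix a \<beta> assume a: "a \<in> carrier_vec n" "sparse_vec k a" and valid: "valid_ineq a \<beta> ((*\<^sub>v) A ` ?P)"
    define b where "b = transpose_mat A *\<^sub>v a"
    define I where "I = {i. i < n \<and> a $ i \<noteq> 0}"
    have ab: "a \<bullet> (A *\<^sub>v z) = (\<Sum>j<n. b $ j * z $ j)" if "z \<in> carrier_vec n" for z
      using transpose_vec_mult_scalar[OF A that a(1)] that
      by (simp add: b_def scalar_prod_def atLeast0LessThan)
    have bj: "b $ j = (\<Sum>i\<in>I. a $ i * A $$ (i, j))" if "j < n" for j
    proof -
      have "b $ j = (\<Sum>i<n. a $ i * A $$ (i, j))"
        using A a that by (simp add: b_def scalar_prod_def atLeast0LessThan mult.commute)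
      also have "\<dots> = (\<Sum>i\<in>I. a $ i * A $$ (i, j))"
        by (rule sum.mono_neutral_right) (auto simp: I_def)
      finally show ?thesis .
    qed
    have "I \<in> small_subsets {..<n} m"
      using a k by (auto simp: small_subsets_def sparse_vec_def I_def m_def)
    moreover have "{j\<in>{..<n}. 0 \<le> b $ j} \<in> sign_patterns (\<lambda>i j. A $$ (i, j)) {..<n} I"
      unfolding sign_patterns_def by (rule range_eqI[of _ _ "($) a"]) (auto simp: bj)
    ultimately have "m < card (sym_diff S {j\<in>{..<n}. 0 \<le> b $ j})" by (rule far)
    \<comment> \<open>The strict inequality absorbs the rounding in \<open>n div 24\<close>.\<close>
    then have "n \<le> 24 * card (sym_diff S {j\<in>{..<n}. 0 \<le> b $ j})" unfolding m_def by linarith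
    from symmetrized_budget_support[OF n S this] obtain x where x: "x \<in> ?P"
      "(25 / 48) * (\<Sum>i<n. b $ i * (if i \<in> S then 1 else - 1)) \<le> (\<Sum>i<n. b $ i * x $ i)" .
    have "a \<bullet> (A *\<^sub>v y) = (25 / 48) * (\<Sum>i<n. b $ i * (if i \<in> S then 1 else - 1))"
      unfolding ab[OF y] sum_distrib_left by (intro sum.cong) (auto simp: y_def)
    also have "\<dots> \<le> a \<bullet> (A *\<^sub>v x)" using x PC ab by auto
    also have "\<dots> \<le> \<beta>" using valid x(1) by (auto simp: valid_ineq_def)
    finally show "a \<bullet> (A *\<^sub>v y) \<le> \<beta>" .
  qed
  then show thesis using that[OF y] by (auto simp: y_def)
qed

lemma poly_dist_rotated_symmetrized_budget:
  assumes n: "n = 2 * h" "0 < h" and k: "24 * k \<le> n" "0 < k"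
    and A: "A \<in> carrier_mat n n" "transpose_mat A * A = 1\<^sub>m n"
  defines "P \<equiv> symmetrized n (budget_polytope (real n / 2) n)"
  shows "1 / 48 * sqrt n \<le> poly_dist ((*\<^sub>v) A ` P) (sparse_closure n k ((*\<^sub>v) A ` P))"
proof -
  obtain y where y: "y \<in> carrier_vec n" "\<And>i. i < n \<Longrightarrow> \<bar>y $ i\<bar> = 25 / 48"
    "A *\<^sub>v y \<in> sparse_closure n k ((*\<^sub>v) A ` P)"
    using signed_point_in_sparse_closure[OF n k(1) A(1)] unfolding P_def by blast
  have P: "x \<in> carrier_vec n" "(\<Sum>i<n. \<bar>x $ i\<bar>) \<le> n / 2" if "x \<in> P" for x
    using that symmetrized_budget_subset unfolding P_def by blast+
  \<comment> \<open>The empty \<open>T\<close> yields the zero vector, the base point for the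
    boundedness argument.\<close>
  have "vec n (\<lambda>i. if i \<in> {} then if 0 \<le> (0::real) then 1 else - 1 else 0) \<in> P"
    unfolding P_def by (rule signed_indicator_in_symmetrized_budget) auto
  then have "0\<^sub>v n \<in> P" by (simp add: zero_vec_def)
  moreover have "A *\<^sub>v 0\<^sub>v n = 0\<^sub>v n" using A(1) by (intro eq_vecI) auto
  ultimately have 0: "0\<^sub>v n \<in> (*\<^sub>v) A ` P" by (metis imageI)
  show ?thesis
  proof (rule poly_dist_ge[OF y(3) _ 0])
    fix z assume "z \<in> (*\<^sub>v) A ` P"
    then obtain x where x: "x \<in> P" "z = A *\<^sub>v x" by blast
    have xc: "x \<in> carrier_vec n" using P x by blast
    have "(\<Sum>i<n. \<bar>y $ i\<bar>) = (\<Sum>i<n. 25 / 48)" using y(2) by (intro sum.cong) auto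
    \<comment> \<open>The l1 gap of \<open>n / 48\<close> between \<open>y\<close> and any point of
      \<open>P\<close> becomes a Euclidean gap, which the isometry \<open>A\<close> then carries to
      the image.\<close>
    then have "1 / 48 * real n \<le> (\<Sum>i<n. \<bar>y $ i\<bar>) - (\<Sum>i<n. \<bar>x $ i\<bar>)"
      using P(2)[OF x(1)] by simp
    also have "\<dots> \<le> (\<Sum>i<n. \<bar>(y - x) $ i\<bar>)"
      unfolding sum_subtractf[symmetric] using y(1) xc by (intro sum_mono) auto
    finally have "1 / 48 * sqrt n \<le> l2_norm_vec (y - x)"
      using y(1) xc by (intro sqrt_mult_le_l2_norm_vec) auto
    also have "\<dots> = l2_norm_vec (A *\<^sub>v (y - x))"
      using A y(1) xc by (intro l2_norm_vec_orthogonal[symmetric]) auto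
    also have "A *\<^sub>v (y - x) = A *\<^sub>v y - z"
      unfolding x(2) using A(1) y(1) xc by (rule mult_minus_distrib_mat_vec)
    finally show "1 / 48 * sqrt n \<le> l2_norm_vec (A *\<^sub>v y - z)" .
  next
    fix x assume x: "x \<in> sparse_closure n k ((*\<^sub>v) A ` P)"
    \<comment> \<open>A crude bound suffices, since it only ensures that the supremum is finite:
      rotated coordinates are at most the Euclidean norm, hence at most the l1 norm.\<close>
    have "l2_norm_vec x \<le> n * (n / 2)"
    proof (rule sparse_closure_bounded[OF k(2) _ _ x])
      show "(*\<^sub>v) A ` P \<subseteq> carrier_vec n" using A(1) P(1) by auto
      fix z i assume "z \<in> (*\<^sub>v) A ` P" "i < n"
      then obtain w where w: "w \<in> P" "z = A *\<^sub>v w" by blast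
      have "\<bar>z $ i\<bar> \<le> l2_norm_vec z"
        using w P(1) A(1) \<open>i < n\<close> by (intro abs_index_le_l2_norm_vec) auto
      also have "\<dots> = l2_norm_vec w"
        unfolding w(2) using A P(1)[OF w(1)] by (rule l2_norm_vec_orthogonal)
      also have "\<dots> \<le> n / 2" using l2_norm_vec_le_l1 P[OF w(1)] by fastforce
      finally show "\<bar>z $ i\<bar> \<le> n / 2" .
    qed
    moreover have "x - 0\<^sub>v n = x" using x by (auto simp: sparse_closure_def)
    ultimately show "l2_norm_vec (x - 0\<^sub>v n) \<le> n * (n / 2)" by simp
  qed
qed

theorem theorem7:
  "\<exists>c::real. c > 0 \<and> (\<exists>n0::nat. \<forall>n::nat. n > 0 \<longrightarrow> even n \<longrightarrow> n \<ge> n0 \<longrightarrow>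
     (\<forall>R. is_rotation n R \<longrightarrow>
       (\<forall>k::nat. k > 0 \<longrightarrow> real k \<le> real n / 200 ^ 3 \<longrightarrow>
         (let P = symmetrized n (budget_polytope (real n / 2) n)
          in poly_dist (R ` P) (sparse_closure n k (R ` P)) \<ge> c * sqrt (real n)))))"
proof (intro exI[of _ "1 / 48"] exI[of _ 0] conjI allI impI)
  fix n k :: nat and R
  assume n: "0 < n" "even n" and R: "is_rotation n R" and k: "0 < k" "real k \<le> real n / 200 ^ 3"
  obtain h where h: "n = 2 * h" "0 < h" using n by auto
  obtain A where A: "A \<in> carrier_mat n n" "transpose_mat A * A = 1\<^sub>m n"
      "\<forall>x\<in>carrier_vec n. R x = A *\<^sub>v x"
    using R by (auto simp: is_rotation_def)
  have "symmetrized n (budget_polytope (real n / 2) n) \<subseteq> carrier_vec n"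
    using symmetrized_budget_subset by blast
  then have "R ` symmetrized n (budget_polytope (real n / 2) n)
      = (*\<^sub>v) A ` symmetrized n (budget_polytope (real n / 2) n)"
    using A(3) by (intro image_cong) auto
  \<comment> \<open>The hypothesis says \<open>8000000 * k <= n\<close>, far stronger than what the
    counting uses.\<close>
  moreover have "24 * k \<le> n" using k(2) by (simp add: field_simps)
  ultimately show "let P = symmetrized n (budget_polytope (real n / 2) n)
      in 1 / 48 * sqrt (real n) \<le> poly_dist (R ` P) (sparse_closure n k (R ` P))"
    using poly_dist_rotated_symmetrized_budget[OF h _ k(1) A(1,2)] by (simp add: Let_def)
qed simp

end
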